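(* There are no totally umbilical surfaces in $\mathcal{H}_3$; that is, no (non-empty) smooth surface $S\subset\mathcal{H}_3$ is totally umbilical.
   Context: The Heisenberg group $\mathcal{H}_3$ is $\mathbb{R}^3$ with the product $(x_1,y_1,z_1)*(x_2,y_2,z_2)=(x_1+x_2,\,y_1+y_2,\,z_1+z_2+\frac{x_1y_2-x_2y_1}{2})$, equipped with the left-invariant Riemannian metric $ds^2=dx^2+dy^2+(\frac12 y\,dx-\frac12 x\,dy+dz)^2$ with Riemannian connection $\nabla$. For a surface $S$ with (local) unit normal field $\eta$, the Weingarten operator is $A_\eta v=-\nabla_v\eta$, $v\in T_pS$. The surface $S$ is totally umbilical if at every point $p\in S$ one has $A_\eta=\lambda(p)\,\mathrm{Id}_{T_pS}$ for some real number $\lambda(p)$. *)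

theory Defs
  imports "HOL-Analysis.Analysis"
begin

primrec Ck_on :: "nat \<Rightarrow> 'a::real_normed_vector set \<Rightarrow> ('a \<Rightarrow> 'b::real_normed_vector) \<Rightarrow> bool" where
  "Ck_on 0 U f \<longleftrightarrow> continuous_on U f"
| "Ck_on (Suc k) U f \<longleftrightarrow>
     (\<forall>x\<in>U. f differentiable (at x)) \<and> (\<forall>v. Ck_on k U (\<lambda>x. frechet_derivative f (at x) v))"

text \<open>Intended for open \<open>U\<close> in a finite-dimensional space.\<close>

definition Cinf_on :: "'a::real_normed_vector set \<Rightarrow> ('a \<Rightarrow> 'b::real_normed_vector) \<Rightarrow> bool" where
  "Cinf_on U f \<longleftrightarrow> (\<forall>k. Ck_on k U f)"

text \<open>All tangent spaces of \<open>\<real>\<^sup>3\<close> are identified with \<open>\<real>\<^sup>3\<close> by means of the coordinate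
  frame; \<open>g p u v\<close> is the inner product of \<open>u\<close> and \<open>v\<close> at the point \<open>p\<close>.\<close>

type_synonym metric3 = "real^3 \<Rightarrow> real^3 \<Rightarrow> real^3 \<Rightarrow> real"

definition gram :: "metric3 \<Rightarrow> real^3 \<Rightarrow> real^3^3" where
  "gram g p = (\<chi> i j. g p (axis i 1) (axis j 1))"

definition dgram :: "metric3 \<Rightarrow> real^3 \<Rightarrow> 3 \<Rightarrow> 3 \<Rightarrow> 3 \<Rightarrow> real" where
  "dgram g p m i j = frechet_derivative (\<lambda>q. gram g q $ i $ j) (at p) (axis m 1)"

definition christoffel :: "metric3 \<Rightarrow> real^3 \<Rightarrow> 3 \<Rightarrow> 3 \<Rightarrow> 3 \<Rightarrow> real" where
  "christoffel g p k i j =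
     (1/2) * (\<Sum>l\<in>UNIV. matrix_inv (gram g p) $ k $ l *
               (dgram g p i j l + dgram g p j i l - dgram g p l i j))"

text \<open>\<open>nabla g Y p v\<close> is \<open>\<nabla>\<^sub>v Y\<close> at \<open>p\<close>, for the Riemannian (Levi-Civita) connection of \<open>g\<close>.\<close>

definition nabla :: "metric3 \<Rightarrow> (real^3 \<Rightarrow> real^3) \<Rightarrow> real^3 \<Rightarrow> real^3 \<Rightarrow> real^3" where
  "nabla g Y p v = frechet_derivative Y (at p) v +
     (\<chi> k. \<Sum>i\<in>UNIV. \<Sum>j\<in>UNIV. christoffel g p k i j * v $ i * Y p $ j)"

definition smooth_surface :: "(real^3) set \<Rightarrow> bool" where
  "smooth_surface S \<longleftrightarrow>
     (\<forall>p\<in>S. \<exists>(U::(real^2) set) V \<phi> \<psi>. open U \<and> open V \<and> p \<in> V \<and>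
        Cinf_on U \<phi> \<and> (\<forall>u\<in>U. inj (frechet_derivative \<phi> (at u))) \<and>
        homeomorphism U (S \<inter> V) \<phi> \<psi>)"

definition tangent_space :: "(real^3) set \<Rightarrow> real^3 \<Rightarrow> (real^3) set" where
  "tangent_space S p = {v. \<exists>\<epsilon>>0. \<exists>\<gamma>::real \<Rightarrow> real^3. Cinf_on {-\<epsilon><..<\<epsilon>} \<gamma> \<and>
     \<gamma> ` {-\<epsilon><..<\<epsilon>} \<subseteq> S \<and> \<gamma> 0 = p \<and> (\<gamma> has_vector_derivative v) (at 0)}"

text \<open>A smooth unit normal field on the piece \<open>S \<inter> W\<close> of \<open>S\<close>. Smoothness along \<open>S\<close> is expressed
  by a smooth extension to the ambient open set \<open>W\<close>, so \<open>\<eta>\<close> denotes such an extension; its values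
  off \<open>S\<close> are irrelevant (cf. \<open>weingarten_cong\<close> below).\<close>

definition unit_normal_on :: "metric3 \<Rightarrow> (real^3) set \<Rightarrow> (real^3) set \<Rightarrow> (real^3 \<Rightarrow> real^3) \<Rightarrow> bool" where
  "unit_normal_on g S W \<eta> \<longleftrightarrow> open W \<and> Cinf_on W \<eta> \<and>
     (\<forall>q\<in>S \<inter> W. g q (\<eta> q) (\<eta> q) = 1 \<and> (\<forall>v\<in>tangent_space S q. g q (\<eta> q) v = 0))"

definition weingarten :: "metric3 \<Rightarrow> (real^3 \<Rightarrow> real^3) \<Rightarrow> real^3 \<Rightarrow> real^3 \<Rightarrow> real^3" where
  "weingarten g \<eta> p v = - nabla g \<eta> p v"

text \<open>The local unit normal field is unique up to sign near \<open>p\<close>, so its choice does not matter.\<close>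

definition umbilical_at :: "metric3 \<Rightarrow> (real^3) set \<Rightarrow> real^3 \<Rightarrow> bool" where
  "umbilical_at g S p \<longleftrightarrow> (\<exists>W \<eta>. p \<in> W \<and> unit_normal_on g S W \<eta> \<and>
     (\<exists>l::real. \<forall>v\<in>tangent_space S p. weingarten g \<eta> p v = l *\<^sub>R v))"

definition totally_umbilical :: "metric3 \<Rightarrow> (real^3) set \<Rightarrow> bool" where
  "totally_umbilical g S \<longleftrightarrow> (\<forall>p\<in>S. umbilical_at g S p)"

definition heis_mult :: "real^3 \<Rightarrow> real^3 \<Rightarrow> real^3" where
  "heis_mult p q = vector [p$1 + q$1, p$2 + q$2, p$3 + q$3 + (p$1 * q$2 - q$1 * p$2) / 2]"

definition heis_form :: "real^3 \<Rightarrow> real^3 \<Rightarrow> real" where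
  "heis_form p v = (1/2) * p$2 * v$1 - (1/2) * p$1 * v$2 + v$3"

definition heis_metric :: metric3 where
  "heis_metric p u v = u$1 * v$1 + u$2 * v$2 + heis_form p u * heis_form p v"

lemma weingarten_cong:
  assumes "open W" "p \<in> S \<inter> W" and eq: "\<And>q. q \<in> S \<inter> W \<Longrightarrow> \<eta> q = \<eta>' q"
    and d: "\<eta> differentiable (at p)" "\<eta>' differentiable (at p)" and v: "v \<in> tangent_space S p"
  shows "weingarten g \<eta> p v = weingarten g \<eta>' p v"
proof -
  obtain \<epsilon> \<gamma> where e: "\<epsilon> > 0" "\<gamma> ` {-\<epsilon><..<\<epsilon>} \<subseteq> S" "\<gamma> 0 = p" "(\<gamma> has_vector_derivative v) (at (0::real))"
    using v unfolding tangent_space_def by blast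
  have g: "(\<gamma> has_derivative (\<lambda>t. t *\<^sub>R v)) (at 0)"
    using e(4) by (simp add: has_vector_derivative_def)
  have der: "((\<lambda>t. \<xi> (\<gamma> t)) has_derivative (\<lambda>t. frechet_derivative \<xi> (at p) (t *\<^sub>R v))) (at 0)"
    if "\<xi> differentiable (at p)" for \<xi> :: "real^3 \<Rightarrow> real^3"
    using has_derivative_compose[OF g, of \<xi> "frechet_derivative \<xi> (at p)"] that e(3)
    by (simp add: frechet_derivative_works)
  have "isCont \<gamma> 0" using g has_derivative_continuous by blast
  then have "\<forall>\<^sub>F t in at 0. \<gamma> t \<in> W"
    using assms(1,2) e(3) by (auto simp: isCont_def intro: topological_tendstoD)
  moreover have "\<forall>\<^sub>F t in at 0. t \<in> {-\<epsilon><..<\<epsilon>}"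
    using e(1) by (intro eventually_at_in_open') auto
  ultimately have ev: "\<forall>\<^sub>F t in at 0. \<eta> (\<gamma> t) = \<eta>' (\<gamma> t)"
    by eventually_elim (use e(2) eq in blast)
  have "\<eta> (\<gamma> 0) = \<eta>' (\<gamma> 0)" using e(3) eq assms(2) by simp
  then have D: "((\<lambda>t. \<eta>' (\<gamma> t)) has_derivative (\<lambda>t. frechet_derivative \<eta> (at p) (t *\<^sub>R v))) (at 0)"
    using has_derivative_transform_eventually[OF der[OF d(1)] ev] by simp
  have "(\<lambda>t::real. frechet_derivative \<eta> (at p) (t *\<^sub>R v)) = (\<lambda>t. frechet_derivative \<eta>' (at p) (t *\<^sub>R v))"
    using D der[OF d(2)] by (rule has_derivative_unique)
  from fun_cong[OF this, of 1]
  have "frechet_derivative \<eta> (at p) v = frechet_derivative \<eta>' (at p) v" by simp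
  then show ?thesis
    using eq[OF assms(2)] by (simp add: weingarten_def nabla_def)
qed

lemma heis_metric_left_invariant:
  "heis_metric (heis_mult a p) (frechet_derivative (heis_mult a) (at p) u)
      (frechet_derivative (heis_mult a) (at p) v) = heis_metric p u v"
proof -
  define L :: "real^3 \<Rightarrow> real^3"
    where "L = (\<lambda>u. vector [u$1, u$2, u$3 + (a$1 * u$2 - u$1 * a$2) / 2])"
  have "linear L"
    by (rule linearI) (simp_all add: L_def vec_eq_iff forall_3 algebra_simps add_divide_distrib diff_divide_distrib)
  then have "(L has_derivative L) (at p)"
    by (simp add: linear_conv_bounded_linear bounded_linear_imp_has_derivative)
  then have "((\<lambda>q. a + L q) has_derivative L) (at p)"
    by (auto intro!: derivative_eq_intros)
  moreover have "heis_mult a = (\<lambda>q. a + L q)"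
    by (rule ext) (simp add: heis_mult_def L_def vec_eq_iff forall_3)
  ultimately have "frechet_derivative (heis_mult a) (at p) = L"
    by (metis frechet_derivative_at)
  then show ?thesis
    by (simp add: L_def heis_metric_def heis_form_def heis_mult_def field_simps)
qed

lemma matrix_inv_gram_heis:
  "matrix_inv (gram heis_metric p) =
     vector [vector [1, 0, - p$2 / 2], vector [0, 1, p$1 / 2],
             vector [- p$2 / 2, p$1 / 2, 1 + ((p$1)\<^sup>2 + (p$2)\<^sup>2) / 4]]" (is "_ = ?B")
proof -
  let ?A = "gram heis_metric p"
  have 1: "?A ** ?B = mat 1" "?B ** ?A = mat 1"
    by (simp_all add: gram_def heis_metric_def heis_form_def matrix_matrix_mult_def mat_def
        vec_eq_iff forall_3 sum_3 axis_def field_simps power2_eq_square)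
  then have "\<exists>B. ?A ** B = mat 1 \<and> B ** ?A = mat 1" by blast
  then have "?A ** matrix_inv ?A = mat 1"
    unfolding matrix_inv_def by (rule someI2_ex) simp
  then have "?B ** (?A ** matrix_inv ?A) = ?B" by simp
  then show ?thesis unfolding matrix_mul_assoc 1(2) by simp
qed

lemma has_derivative_nth:
  "(f has_derivative f') F \<Longrightarrow> ((\<lambda>x. f x $ i) has_derivative (\<lambda>h. f' h $ i)) F"
  by (rule bounded_linear.has_derivative[OF bounded_linear_vec_nth])

lemma dgram_heis:
  "dgram heis_metric p m i j = heis_form (axis m 1) (axis i 1) * heis_form p (axis j 1)
     + heis_form p (axis i 1) * heis_form (axis m 1) (axis j 1)
     - heis_form 0 (axis i 1) * heis_form p (axis j 1)
     - heis_form p (axis i 1) * heis_form 0 (axis j 1)"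
proof -
  have "((\<lambda>q. gram heis_metric q $ i $ j) has_derivative
      (\<lambda>h. (heis_form h (axis i 1) - heis_form 0 (axis i 1)) * heis_form p (axis j 1)
        + heis_form p (axis i 1) * (heis_form h (axis j 1) - heis_form 0 (axis j 1)))) (at p)"
    unfolding gram_def heis_metric_def heis_form_def vec_lambda_beta
    by (rule derivative_eq_intros has_derivative_nth refl ext | simp add: algebra_simps)+
  from frechet_derivative_at[OF this, symmetric] show ?thesis
    by (simp add: dgram_def algebra_simps)
qed

lemma christoffel_heis:
  "christoffel heis_metric p 1 i j =
     (if i = 1 \<and> j = 1 then 0
      else if i = 1 \<and> j = 2 \<or> i = 2 \<and> j = 1 then p$2 / 4
      else if i = 2 \<and> j = 2 then - p$1 / 2
      else if i = 2 \<and> j = 3 \<or> i = 3 \<and> j = 2 then 1 / 2 else 0)"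
  "christoffel heis_metric p 2 i j =
     (if i = 1 \<and> j = 1 then - p$2 / 2
      else if i = 1 \<and> j = 2 \<or> i = 2 \<and> j = 1 then p$1 / 4
      else if i = 1 \<and> j = 3 \<or> i = 3 \<and> j = 1 then - 1 / 2 else 0)"
  "christoffel heis_metric p 3 i j =
     (if i = 1 \<and> j = 1 then - p$1 * p$2 / 4
      else if i = 1 \<and> j = 2 \<or> i = 2 \<and> j = 1 then ((p$1)\<^sup>2 - (p$2)\<^sup>2) / 8
      else if i = 2 \<and> j = 2 then p$1 * p$2 / 4
      else if i = 1 \<and> j = 3 \<or> i = 3 \<and> j = 1 then - p$1 / 4
      else if i = 2 \<and> j = 3 \<or> i = 3 \<and> j = 2 then - p$2 / 4 else 0)"
  using exhaust_3[of i] exhaust_3[of j]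
  by (elim disjE; simp add: christoffel_def matrix_inv_gram_heis dgram_heis sum_3 heis_form_def
      axis_def field_simps power2_eq_square)+

text \<open>Hence \<open>nabla heis_metric\<close> is torsion-free and metric, i.e. it is the Riemannian connection.\<close>

lemma nabla_heis_torsion_free:
  "nabla heis_metric Y p (X p) - nabla heis_metric X p (Y p)
     = frechet_derivative Y (at p) (X p) - frechet_derivative X (at p) (Y p)"
  by (simp add: nabla_def christoffel_heis vec_eq_iff forall_3 sum_3 algebra_simps)

lemma nabla_heis_metric_compatible:
  assumes "Y differentiable (at p)" "Z differentiable (at p)"
  shows "((\<lambda>q. heis_metric q (Y q) (Z q)) has_derivative
    (\<lambda>v. heis_metric p (nabla heis_metric Y p v) (Z p)
       + heis_metric p (Y p) (nabla heis_metric Z p v))) (at p)"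
proof -
  note Y = assms(1)[unfolded frechet_derivative_works]
  note Z = assms(2)[unfolded frechet_derivative_works]
  define G where "G = (\<lambda>(v::real^3) (y::real^3). \<chi> k. \<Sum>i\<in>UNIV. \<Sum>j\<in>UNIV.
    christoffel heis_metric p k i j * v $ i * y $ j)"
  define w where "w = (\<lambda>(v::real^3) (y::real^3). (v$2 * y$1 - v$1 * y$2) / 2)"
  have G: "G v y $ 1 = p$2 * (v$1 * y$2 + v$2 * y$1) / 4 - p$1 * v$2 * y$2 / 2 + (v$2 * y$3 + v$3 * y$2) / 2"
    "G v y $ 2 = - p$2 * v$1 * y$1 / 2 + p$1 * (v$1 * y$2 + v$2 * y$1) / 4 - (v$1 * y$3 + v$3 * y$1) / 2"
    "heis_form p (G v y) = - p$1 * p$2 * v$1 * y$1 / 4 + ((p$1)\<^sup>2 - (p$2)\<^sup>2) * (v$1 * y$2 + v$2 * y$1) / 8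
       + p$1 * p$2 * v$2 * y$2 / 4 - p$1 * (v$1 * y$3 + v$3 * y$1) / 4 - p$2 * (v$2 * y$3 + v$3 * y$2) / 4
       + p$2 * G v y $ 1 / 2 - p$1 * G v y $ 2 / 2" for v y
    by (simp_all add: G_def christoffel_heis sum_3 heis_form_def algebra_simps add_divide_distrib
        diff_divide_distrib power2_eq_square)
  have G3: "heis_form p (G v y) = 0" for v y
    unfolding G(3) unfolding G(1,2) by (simp add: field_simps power2_eq_square)
  have "w v y * heis_form p z + heis_form p y * w v z
      = heis_metric p (G v y) z + heis_metric p y (G v z)" for v y z
    unfolding heis_metric_def G3 unfolding G(1,2) w_def heis_form_def by (simp add: field_simps)
  moreover have "nabla heis_metric X p v = frechet_derivative X (at p) v + G v (X p)" for X v
    by (simp add: nabla_def G_def)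
  moreover have "heis_metric p (a + b) c = heis_metric p a c + heis_metric p b c"
    "heis_metric p c (a + b) = heis_metric p c a + heis_metric p c b" for a b c
    by (simp_all add: heis_metric_def heis_form_def algebra_simps add_divide_distrib)
  moreover have "((\<lambda>q. heis_metric q (Y q) (Z q)) has_derivative
    (\<lambda>v. heis_metric p (frechet_derivative Y (at p) v) (Z p)
       + heis_metric p (Y p) (frechet_derivative Z (at p) v)
       + (w v (Y p) * heis_form p (Z p) + heis_form p (Y p) * w v (Z p)))) (at p)"
    unfolding heis_metric_def heis_form_def w_def
    by (rule derivative_eq_intros has_derivative_nth[OF Y] has_derivative_nth[OF Z]
        has_derivative_nth[OF has_derivative_ident] refl ext
        | simp add: algebra_simps add_divide_distrib diff_divide_distrib)+
  ultimately show ?thesis by (simp add: add_ac)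
qed

end

theory Submission
  imports Defs
begin

text \<open>Let \<open>a\<close>, \<open>b\<close>, \<open>n\<close> be the components, in the left-invariant orthonormal frame dual to
  \<open>dx\<close>, \<open>dy\<close>, \<open>heis_form\<close>, of the two coordinate fields \<open>\<partial>\<^sub>u\<close>, \<open>\<partial>\<^sub>v\<close> of a parametrization and of the
  unit normal. Umbilicity with factor \<open>l\<close> is the first-order system \<open>\<partial>\<^sub>u n = - l a - conn a n\<close>,
  \<open>\<partial>\<^sub>v n = - l b - conn b n\<close>. Its integrability condition (the Codazzi equation) is
  \<open>\<partial>\<^sub>u l = n\<^sub>3 a\<^sub>3\<close>, \<open>\<partial>\<^sub>v l = n\<^sub>3 b\<^sub>3\<close>, and the integrability condition of that system is
  \<open>3 n\<^sub>3\<^sup>2 = 1\<close>. So \<open>n\<^sub>3\<close> is constant, and the third components of the first system then force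
  \<open>n\<^sub>1 = n\<^sub>2 = 0\<close>, hence \<open>n\<^sub>3\<^sup>2 = 1\<close>, a contradiction.\<close>

section \<open>Symmetry of mixed derivatives\<close>

text \<open>The mean value theorem, applied to \<open>f (x + s *\<^sub>R v + t *\<^sub>R w) - f (x +
  s *\<^sub>R v)\<close> as a function of \<open>s\<close>, turns the second difference into a
  difference of two values of \<open>\<lambda>y. f' y v\<close>. Both are then expanded at
  \<open>x\<close> to first order by \<open>P\<close>.\<close>

lemma second_difference_tendsto:
  fixes f :: "'a::real_normed_vector \<Rightarrow> real"
  assumes "open U" "x \<in> U" and f: "\<And>y. y \<in> U \<Longrightarrow> (f has_derivative f' y) (at y)"
    and P: "((\<lambda>y. f' y v) has_derivative P) (at x)"
  shows "((\<lambda>t. (f (x + t *\<^sub>R v + t *\<^sub>R w) - f (x + t *\<^sub>R v) - f (x + t *\<^sub>R w) + f x) / t\<^sup>2) \<longlongrightarrow> P w)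
    (at_right 0)"
proof (rule tendstoI)
  fix e :: real assume "e > 0"
  \<comment> \<open>Two error terms, each at most \<open>e / K * (t * (norm v + norm w))\<close>,
    will add up to \<open>e * t * ((K - 1) / K)\<close>. The summand 1 makes this strictly less than
    \<open>e * t\<close> and keeps \<open>K\<close> positive even if \<open>v\<close> and
    \<open>w\<close> vanish.\<close>
  define K where "K = 2 * (norm v + norm w) + 1"
  have K: "K > 0" by (simp add: K_def add_nonneg_pos)
  obtain r where r: "r > 0" "ball x r \<subseteq> U"
    using assms(1,2) openE by blast
  have "e / K > 0" using \<open>e > 0\<close> K by simp
  then obtain d where d: "d > 0"
    "\<And>y. norm (y - x) < d \<Longrightarrow> norm (f' y v - f' x v - P (y - x)) \<le> e / K * norm (y - x)"
    using P unfolding has_derivative_at_alt by blast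
  interpret P: linear P using P by (rule has_derivative_linear)
  have small: "norm (s *\<^sub>R v + t' *\<^sub>R w) \<le> t * (norm v + norm w)"
    if "0 \<le> s" "s \<le> t" "0 \<le> t'" "t' \<le> t" for s t' t
    using norm_triangle_ineq[of "s *\<^sub>R v" "t' *\<^sub>R w"] that
      mult_right_mono[of s t "norm v"] mult_right_mono[of t' t "norm w"]
    by (simp add: algebra_simps)
  \<comment> \<open>For such \<open>t\<close> the whole parallelogram spanned at \<open>x\<close> by
    \<open>t *\<^sub>R v\<close> and \<open>t *\<^sub>R w\<close> lies in the ball inside
    \<open>U\<close> and within the range of the estimate for \<open>P\<close>.\<close>
  have "\<forall>\<^sub>F t in at_right 0. t \<in> {0<..<min r d / K}"
    by (rule eventually_at_right_real) (use r d K in auto)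
  then show "\<forall>\<^sub>F t in at_right 0. dist ((f (x + t *\<^sub>R v + t *\<^sub>R w) - f (x + t *\<^sub>R v)
      - f (x + t *\<^sub>R w) + f x) / t\<^sup>2) (P w) < e"
  proof eventually_elim
    case (elim t)
    then have t: "t > 0" "t * K < min r d" using K by (auto simp: field_simps)
    moreover have "t * (norm v + norm w) \<le> t * K"
      using t(1) by (intro mult_left_mono) (simp_all add: K_def)
    ultimately have near: "norm (s *\<^sub>R v + t' *\<^sub>R w) < min r d"
      if "0 \<le> s" "s \<le> t" "0 \<le> t'" "t' \<le> t" for s t'
      using small[OF that] by linarith
    have inU: "x + s *\<^sub>R v + t' *\<^sub>R w \<in> U" if "0 \<le> s" "s \<le> t" "0 \<le> t'" "t' \<le> t" for s t'
      using near[OF that] r(2) by (auto simp: subset_iff dist_norm norm_minus_commute add.assoc)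
    define g where "g = (\<lambda>s. f (x + s *\<^sub>R v + t *\<^sub>R w) - f (x + s *\<^sub>R v))"
    have line: "((\<lambda>s. f (y + s *\<^sub>R v)) has_derivative (\<lambda>h. h * f' (y + s *\<^sub>R v) v)) (at s)"
      if "y + s *\<^sub>R v \<in> U" for s y
    proof -
      have "((\<lambda>s. y + s *\<^sub>R v) has_derivative (\<lambda>h. h *\<^sub>R v)) (at s)"
        by (auto intro!: derivative_eq_intros)
      from has_derivative_compose[OF this f[OF that]]
      show ?thesis
        using linear_cmul[OF has_derivative_linear[OF f[OF that]]] by simp
    qed
    have "\<exists>s\<in>{0<..<t}. g t - g 0
        = (t - 0) * (f' (x + s *\<^sub>R v + t *\<^sub>R w) v - f' (x + s *\<^sub>R v) v)"
    proof (rule mvt_simple[OF t(1)])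
      fix s assume s: "0 \<le> s" "s \<le> t"
      have "((\<lambda>s. f (x + t *\<^sub>R w + s *\<^sub>R v) - f (x + s *\<^sub>R v)) has_derivative
          (\<lambda>h. h * f' (x + t *\<^sub>R w + s *\<^sub>R v) v - h * f' (x + s *\<^sub>R v) v)) (at s)"
        using inU[of s t] inU[of s 0] s t(1)
        by (intro has_derivative_diff line) (simp_all add: add_ac)
      then show "(g has_derivative
          (\<lambda>h. h * (f' (x + s *\<^sub>R v + t *\<^sub>R w) v - f' (x + s *\<^sub>R v) v))) (at s within {0..t})"
        unfolding g_def by (simp add: add_ac right_diff_distrib has_derivative_at_withinI)
    qed
    then obtain s where s: "0 < s" "s < t" and
      g: "g t - g 0 = t * (f' (x + s *\<^sub>R v + t *\<^sub>R w) v - f' (x + s *\<^sub>R v) v)"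
      by auto
    have bd: "\<bar>f' (x + s *\<^sub>R v + t' *\<^sub>R w) v - f' x v - P (s *\<^sub>R v + t' *\<^sub>R w)\<bar>
        \<le> e / K * (t * (norm v + norm w))" if "0 \<le> t'" "t' \<le> t" for t'
    proof -
      have "\<bar>f' (x + s *\<^sub>R v + t' *\<^sub>R w) v - f' x v - P (s *\<^sub>R v + t' *\<^sub>R w)\<bar>
          \<le> e / K * norm (s *\<^sub>R v + t' *\<^sub>R w)"
        using d(2)[of "x + s *\<^sub>R v + t' *\<^sub>R w"] near[of s t'] s that by (simp add: add.assoc)
      also have "\<dots> \<le> e / K * (t * (norm v + norm w))"
        using small[of s t t'] s that \<open>e / K > 0\<close> by (intro mult_left_mono) auto
      finally show ?thesis .
    qed
    have "\<bar>f' (x + s *\<^sub>R v + t *\<^sub>R w) v - f' (x + s *\<^sub>R v) v - t * P w\<bar>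
        \<le> 2 * (e / K * (t * (norm v + norm w)))"
      using bd[of t] bd[of 0] t(1) by (simp add: P.add P.scale)
    also have "\<dots> = e * t * ((K - 1) / K)" by (simp add: K_def field_simps)
    also have "\<dots> < e * t * 1"
      using t(1) \<open>e > 0\<close> K by (intro mult_strict_left_mono) simp_all
    finally have *: "\<bar>f' (x + s *\<^sub>R v + t *\<^sub>R w) v - f' (x + s *\<^sub>R v) v - t * P w\<bar> < e * t" by simp
    have "f (x + t *\<^sub>R v + t *\<^sub>R w) - f (x + t *\<^sub>R v) - f (x + t *\<^sub>R w) + f x = g t - g 0"
      by (simp add: g_def)
    then have "(f (x + t *\<^sub>R v + t *\<^sub>R w) - f (x + t *\<^sub>R v) - f (x + t *\<^sub>R w) + f x) / t\<^sup>2 - P w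
       = t * (f' (x + s *\<^sub>R v + t *\<^sub>R w) v - f' (x + s *\<^sub>R v) v) / t\<^sup>2 - P w"
      by (simp only: g)
    also have "\<dots> = (f' (x + s *\<^sub>R v + t *\<^sub>R w) v - f' (x + s *\<^sub>R v) v - t * P w) / t"
      using t(1) by (simp add: field_simps power2_eq_square)
    finally show ?case
      using * t(1) by (simp only: dist_real_def abs_divide abs_of_pos pos_divide_less_eq)
  qed
qed

text \<open>The second difference is symmetric in \<open>v\<close> and \<open>w\<close>, so
  \<open>P w\<close> and \<open>Q v\<close> are limits of the same expression.\<close>

lemma mixed_derivatives_commute_real:
  fixes f :: "'a::real_normed_vector \<Rightarrow> real"
  assumes "open U" "x \<in> U" and f: "\<And>y. y \<in> U \<Longrightarrow> (f has_derivative f' y) (at y)"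
    and P: "((\<lambda>y. f' y v) has_derivative P) (at x)"
    and Q: "((\<lambda>y. f' y w) has_derivative Q) (at x)"
  shows "P w = Q v"
proof (rule tendsto_unique[OF _ second_difference_tendsto[OF assms(1,2) f P]])
  show "((\<lambda>t. (f (x + t *\<^sub>R v + t *\<^sub>R w) - f (x + t *\<^sub>R v) - f (x + t *\<^sub>R w) + f x) / t\<^sup>2) \<longlongrightarrow> Q v)
    (at_right 0)"
    using second_difference_tendsto[OF assms(1,2) f Q, of v] by (simp add: algebra_simps)
qed auto

lemma mixed_derivatives_commute:
  fixes f :: "'a::real_normed_vector \<Rightarrow> 'b::euclidean_space"
  assumes "open U" "x \<in> U" and f: "\<And>y. y \<in> U \<Longrightarrow> (f has_derivative f' y) (at y)"
    and P: "((\<lambda>y. f' y v) has_derivative P) (at x)"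
    and Q: "((\<lambda>y. f' y w) has_derivative Q) (at x)"
  shows "P w = Q v"
proof (rule euclidean_eqI)
  fix i :: 'b
  show "P w \<bullet> i = Q v \<bullet> i"
    using assms
    by (intro mixed_derivatives_commute_real[of U x "\<lambda>y. f y \<bullet> i" "\<lambda>y h. f' y h \<bullet> i"])
      (auto intro: has_derivative_inner_left)
qed

section \<open>The umbilicity equations in the left-invariant frame\<close>

text \<open>\<open>conn a n\<close> is the covariant derivative along \<open>a\<close> of the field with constant components \<open>n\<close>,
  both given in the left-invariant frame.\<close>

definition conn :: "real^3 \<Rightarrow> real^3 \<Rightarrow> real^3" where
  "conn a n = vector [(a$2 * n$3 + a$3 * n$2) / 2, - (a$1 * n$3 + a$3 * n$1) / 2,
     (a$1 * n$2 - a$2 * n$1) / 2]"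

lemma bounded_bilinear_conn: "bounded_bilinear conn"
  unfolding bilinear_conv_bounded_bilinear[symmetric] bilinear_def
  by (auto intro!: linearI simp: conn_def vec_eq_iff forall_3 field_simps)

text \<open>Lagrange's identity shows that \<open>n\<close> has zero cross product with
  \<open>cross3 a b\<close>; expanding the double product of \<open>n\<close>, \<open>n\<close> and
  \<open>cross3 a b\<close> then isolates \<open>cross3 a b\<close>.\<close>

lemma cross_eq_scaleR_normal:
  fixes a b n :: "real^3"
  assumes "n \<bullet> n = 1" "n \<bullet> a = 0" "n \<bullet> b = 0"
  shows "cross3 a b = (cross3 a b \<bullet> n) *\<^sub>R n"
proof -
  have "cross3 n (cross3 a b) = 0"
    using Lagrange[of n a b] assms by simp
  moreover have "cross3 n (cross3 n (cross3 a b)) = (n \<bullet> cross3 a b) *\<^sub>R n - (n \<bullet> n) *\<^sub>R cross3 a b"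
    by (rule Lagrange)
  ultimately show ?thesis using assms by (simp add: inner_commute)
qed

section \<open>Integrability conditions of the umbilicity system\<close>

text \<open>Here \<open>av\<close>, \<open>nv\<close>, \<open>lv\<close> stand for derivatives in
  the second parameter and \<open>bu\<close>, \<open>nu\<close>, \<open>lu\<close> for those in the
  first; \<open>eq\<close> is the equality of the mixed derivatives of \<open>n\<close>. It becomes
  a linear relation between \<open>a\<close> and \<open>b\<close>, whose independence gives both
  equations.\<close>

lemma umbilical_codazzi:
  fixes a b n :: "real^3"
  assumes n: "n \<bullet> n = 1" "n \<bullet> a = 0" "n \<bullet> b = 0" and ab: "cross3 a b \<noteq> 0"
    and nu: "nu = - l *\<^sub>R a - conn a n" and nv: "nv = - l *\<^sub>R b - conn b n"
    and t: "av - bu = (a$1 * b$2 - a$2 * b$1) *\<^sub>R axis 3 1"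
    and eq: "- lv *\<^sub>R a - l *\<^sub>R av - (conn a nv + conn av n)
      = - lu *\<^sub>R b - l *\<^sub>R bu - (conn b nu + conn bu n)"
  shows "lu = n$3 * a$3" "lv = n$3 * b$3"
proof -
  define s where "s = cross3 a b \<bullet> n"
  have "cross3 a b = s *\<^sub>R n" unfolding s_def using cross_eq_scaleR_normal[OF n] .
  then have c: "a$2 * b$3 - a$3 * b$2 = s * n$1" "a$3 * b$1 - a$1 * b$3 = s * n$2"
    "a$1 * b$2 - a$2 * b$1 = s * n$3"
    by (auto simp: cross3_def vec_eq_iff forall_3)
  have av: "av = bu + (s * n$3) *\<^sub>R axis 3 1" using t c(3) by (simp add: algebra_simps)
  have "lu *\<^sub>R b - lv *\<^sub>R a = l *\<^sub>R (av - bu) + (conn a nv - conn b nu) + conn (av - bu) n"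
    using eq by (simp add: bounded_bilinear.diff_left[OF bounded_bilinear_conn] algebra_simps)
  \<comment> \<open>The terms with \<open>l\<close> cancel because
    \<open>conn a b - conn b a\<close> equals the torsion term \<open>av - bu\<close>. What is left
    is the curvature of the connection applied to \<open>n\<close>, up to sign, evaluated by means
    of \<open>c\<close> and \<open>n'\<close>.\<close>
  also have "\<dots> = n$3 *\<^sub>R (a$3 *\<^sub>R b - b$3 *\<^sub>R a)"
  proof -
    have n': "n$1 * n$1 + n$2 * n$2 + n$3 * n$3 = 1" "n$1 * a$1 + n$2 * a$2 + n$3 * a$3 = 0"
      "n$1 * b$1 + n$2 * b$2 + n$3 * b$3 = 0"
      using n by (simp_all add: inner_vec_def sum_3)
    show ?thesis
      unfolding vec_eq_iff forall_3 av nu nv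
      by (simp add: conn_def axis_def field_simps, intro conjI; use c n' in algebra)
  qed
  finally have *: "(lu - n$3 * a$3) *\<^sub>R b = (lv - n$3 * b$3) *\<^sub>R a" by (simp add: algebra_simps)
  \<comment> \<open>Taking the cross product of the relation with \<open>a\<close>, respectively
    \<open>b\<close>, kills one of its two sides.\<close>
  then have "(lu - n$3 * a$3) *\<^sub>R cross3 a b = 0" "(lv - n$3 * b$3) *\<^sub>R cross3 a b = 0"
    by (metis cross_mult_right cross_refl scaleR_zero_right,
        metis cross_mult_left cross_refl scaleR_zero_right)
  then show "lu = n$3 * a$3" "lv = n$3 * b$3" using ab by simp_all
qed

text \<open>\<open>eq\<close> is the equality of the mixed derivatives of \<open>l\<close>, whose
  first derivatives are \<open>n$3 * a$3\<close> and \<open>n$3 * b$3\<close>. The torsion and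
  \<open>conn\<close> terms reduce it to 2 times the square of \<open>n$3\<close> being the sum of
  the squares of \<open>n$1\<close> and \<open>n$2\<close>; the unit length of \<open>n\<close> does
  the rest.\<close>

lemma umbilical_vertical_component:
  fixes a b n :: "real^3"
  assumes n: "n \<bullet> n = 1" "n \<bullet> a = 0" "n \<bullet> b = 0" and ab: "cross3 a b \<noteq> 0"
    and nu: "nu = - l *\<^sub>R a - conn a n" and nv: "nv = - l *\<^sub>R b - conn b n"
    and t: "av - bu = (a$1 * b$2 - a$2 * b$1) *\<^sub>R axis 3 1"
    and eq: "n$3 * av$3 + nv$3 * a$3 = n$3 * bu$3 + nu$3 * b$3"
  shows "3 * (n$3)\<^sup>2 = 1"
proof -
  define s where "s = cross3 a b \<bullet> n"
  have cs: "cross3 a b = s *\<^sub>R n" unfolding s_def using cross_eq_scaleR_normal[OF n] .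
  then have c: "a$2 * b$3 - a$3 * b$2 = s * n$1" "a$3 * b$1 - a$1 * b$3 = s * n$2"
    "a$1 * b$2 - a$2 * b$1 = s * n$3"
    by (auto simp: cross3_def vec_eq_iff forall_3)
  have av: "av = bu + (s * n$3) *\<^sub>R axis 3 1" using t c(3) by (simp add: algebra_simps)
  have "s \<noteq> 0" using ab cs by auto
  have n1: "(n$1)\<^sup>2 + (n$2)\<^sup>2 + (n$3)\<^sup>2 = 1"
    using n(1) by (simp add: inner_vec_def sum_3 power2_eq_square)
  have "n$3 * (av$3 - bu$3) + nv$3 * a$3 - nu$3 * b$3 = 0" using eq by (simp add: algebra_simps)
  then have "2 * s * (n$3)\<^sup>2 = n$2 * (b$1 * a$3 - a$1 * b$3) + n$1 * (a$2 * b$3 - b$2 * a$3)"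
    unfolding av nu nv by (simp add: conn_def axis_def field_simps power2_eq_square)
  also have "\<dots> = s * ((n$1)\<^sup>2 + (n$2)\<^sup>2)"
    using c by (simp add: algebra_simps power2_eq_square)
  finally show ?thesis using n1 \<open>s \<noteq> 0\<close> by auto
qed

lemma no_umbilical_constant_angle:
  fixes a b n :: "real^3"
  assumes n: "n \<bullet> n = 1" "n \<bullet> a = 0" "n \<bullet> b = 0" and ab: "cross3 a b \<noteq> 0"
    and n3: "3 * (n$3)\<^sup>2 = 1"
    and nu: "(- l *\<^sub>R a - conn a n) $ 3 = 0" and nv: "(- l *\<^sub>R b - conn b n) $ 3 = 0"
  shows False
proof -
  define s where "s = cross3 a b \<bullet> n"
  have cs: "cross3 a b = s *\<^sub>R n" unfolding s_def using cross_eq_scaleR_normal[OF n] .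
  \<comment> \<open>The hypotheses on the third components say that \<open>m\<close> is orthogonal to the surface.\<close>
  define m :: "real^3" where "m = vector [n$2 / 2, - n$1 / 2, l]"
  have "m \<bullet> a = 0" "m \<bullet> b = 0"
    using nu nv by (auto simp: m_def conn_def inner_vec_def sum_3 field_simps)
  then have "cross3 m (cross3 a b) = 0" by (simp add: Lagrange)
  moreover have "s \<noteq> 0" using ab cs by auto
  ultimately have "cross3 m n = 0" unfolding cs by (simp add: cross_mult_right)
  \<comment> \<open>This component is half the sum of the squares of \<open>n$1\<close> and
    \<open>n$2\<close>, so \<open>n\<close> is vertical.\<close>
  then have "(cross3 m n) $ 3 = 0" by simp
  then have "(n$1)\<^sup>2 + (n$2)\<^sup>2 = 0"
    by (simp add: m_def cross3_def power2_eq_square field_simps)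
  then show False using n(1) n3 by (simp add: inner_vec_def sum_3 power2_eq_square)
qed

text \<open>The torsion hypothesis comes from \<open>[E\<^sub>1, E\<^sub>2] = E\<^sub>3\<close>, the only nonzero bracket of the frame.\<close>

lemma no_umbilical_frame_solution:
  fixes a b n :: "'a::real_normed_vector \<Rightarrow> real^3" and l :: "'a \<Rightarrow> real"
  assumes U: "open U" "U \<noteq> {}"
    and a: "\<And>x. x \<in> U \<Longrightarrow> (a has_derivative a' x) (at x)"
    and b: "\<And>x. x \<in> U \<Longrightarrow> (b has_derivative b' x) (at x)"
    and n: "\<And>x. x \<in> U \<Longrightarrow> (n has_derivative n' x) (at x)"
    and l: "\<And>x. x \<in> U \<Longrightarrow> (l has_derivative l' x) (at x)"
    and unit: "\<And>x. x \<in> U \<Longrightarrow> n x \<bullet> n x = 1"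
    and na: "\<And>x. x \<in> U \<Longrightarrow> n x \<bullet> a x = 0" and nb: "\<And>x. x \<in> U \<Longrightarrow> n x \<bullet> b x = 0"
    and ab: "\<And>x. x \<in> U \<Longrightarrow> cross3 (a x) (b x) \<noteq> 0"
    and nu: "\<And>x. x \<in> U \<Longrightarrow> n' x u = - l x *\<^sub>R a x - conn (a x) (n x)"
    and nv: "\<And>x. x \<in> U \<Longrightarrow> n' x v = - l x *\<^sub>R b x - conn (b x) (n x)"
    and torsion: "\<And>x. x \<in> U \<Longrightarrow>
      a' x v - b' x u = (a x $ 1 * b x $ 2 - a x $ 2 * b x $ 1) *\<^sub>R axis 3 1"
  shows False
proof -
  have rhs: "((\<lambda>y. - l y *\<^sub>R c y - conn (c y) (n y)) has_derivative
      (\<lambda>h. - l' x h *\<^sub>R c x - l x *\<^sub>R c' x h - (conn (c x) (n' x h) + conn (c' x h) (n x)))) (at x)"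
    if "x \<in> U" "(c has_derivative c' x) (at x)" for x c c'
  proof -
    have "((\<lambda>y. - l y *\<^sub>R c y) has_derivative (\<lambda>h. - l' x h *\<^sub>R c x - l x *\<^sub>R c' x h)) (at x)"
      by (rule derivative_eq_intros l that refl)+ (simp add: fun_eq_iff algebra_simps)
    from has_derivative_diff[OF this bounded_bilinear.FDERIV[OF bounded_bilinear_conn that(2) n[OF that(1)]]]
    show ?thesis .
  qed
  have "- l' x v *\<^sub>R a x - l x *\<^sub>R a' x v - (conn (a x) (n' x v) + conn (a' x v) (n x))
      = - l' x u *\<^sub>R b x - l x *\<^sub>R b' x u - (conn (b x) (n' x u) + conn (b' x u) (n x))"
    if x: "x \<in> U" for x
  proof -
    \<comment> \<open>The existence of second derivatives of \<open>n\<close> comes from the system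
      itself: on the open set \<open>U\<close> the function \<open>\<lambda>y. n' y u\<close> equals
      a differentiable right-hand side. The same device serves below for \<open>l\<close>.\<close>
    have 1: "((\<lambda>y. n' y u) has_derivative
      (\<lambda>h. - l' x h *\<^sub>R a x - l x *\<^sub>R a' x h - (conn (a x) (n' x h) + conn (a' x h) (n x)))) (at x)"
      using has_derivative_transform_within_open[OF rhs[where c=a and c'=a', OF x a[OF x]] U(1) x] nu by simp
    have 2: "((\<lambda>y. n' y v) has_derivative
      (\<lambda>h. - l' x h *\<^sub>R b x - l x *\<^sub>R b' x h - (conn (b x) (n' x h) + conn (b' x h) (n x)))) (at x)"
      using has_derivative_transform_within_open[OF rhs[where c=b and c'=b', OF x b[OF x]] U(1) x] nv by simp
    show ?thesis using mixed_derivatives_commute[OF U(1) x n 1 2] by simp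
  qed
  then have lu: "l' x u = n x $ 3 * a x $ 3" and lv: "l' x v = n x $ 3 * b x $ 3" if "x \<in> U" for x
    using umbilical_codazzi[OF unit na nb ab nu nv torsion] that by blast+
  have third: "((\<lambda>y. n y $ 3 * c y $ 3) has_derivative
      (\<lambda>h. n x $ 3 * c' x h $ 3 + n' x h $ 3 * c x $ 3)) (at x)"
    if "x \<in> U" "(c has_derivative c' x) (at x)" for x and c :: "'a \<Rightarrow> real^3" and c'
    using that by (intro has_derivative_mult has_derivative_nth n)
  have "n x $ 3 * a' x v $ 3 + n' x v $ 3 * a x $ 3 = n x $ 3 * b' x u $ 3 + n' x u $ 3 * b x $ 3"
    if x: "x \<in> U" for x
  proof -
    have 1: "((\<lambda>y. l' y u) has_derivative (\<lambda>h. n x $ 3 * a' x h $ 3 + n' x h $ 3 * a x $ 3)) (at x)"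
      using has_derivative_transform_within_open[OF third[where c=a and c'=a', OF x a[OF x]] U(1) x] lu by simp
    have 2: "((\<lambda>y. l' y v) has_derivative (\<lambda>h. n x $ 3 * b' x h $ 3 + n' x h $ 3 * b x $ 3)) (at x)"
      using has_derivative_transform_within_open[OF third[where c=b and c'=b', OF x b[OF x]] U(1) x] lv by simp
    show ?thesis using mixed_derivatives_commute[OF U(1) x l 1 2] by simp
  qed
  then have n3: "3 * (n x $ 3)\<^sup>2 = 1" if "x \<in> U" for x
    using umbilical_vertical_component[OF unit na nb ab nu nv torsion] that by blast
  obtain x where x: "x \<in> U" using U(2) by blast
  \<comment> \<open>Differentiating the constant expression \<open>3 * (n y $ 3)\<^sup>2\<close> and
    dividing by the nonzero \<open>n x $ 3\<close> makes the third component of \<open>n' x\<close>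
    vanish.\<close>
  have "((\<lambda>y. 3 * (n y $ 3)\<^sup>2) has_derivative (\<lambda>h. 6 * n x $ 3 * n' x h $ 3)) (at x)"
    by (rule derivative_eq_intros has_derivative_nth n x refl | simp add: fun_eq_iff)+
  moreover have "((\<lambda>y. 3 * (n y $ 3)\<^sup>2) has_derivative (\<lambda>h. 0)) (at x)"
    by (rule has_derivative_transform_within_open[OF has_derivative_const[of 1] U(1) x]) (simp add: n3)
  ultimately have "(\<lambda>h. 6 * n x $ 3 * n' x h $ 3) = (\<lambda>h. 0)"
    by (rule has_derivative_unique)
  then have "6 * n x $ 3 * n' x h $ 3 = 0" for h by (rule fun_cong)
  moreover have "n x $ 3 \<noteq> 0" using n3[OF x] by auto
  ultimately have "n' x h $ 3 = 0" for h by simp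
  then show False
    using no_umbilical_constant_angle[OF unit na nb ab n3] nu nv x by metis
qed

section \<open>Tangent vectors of a parametrized surface\<close>

text \<open>At points of an open set, Frechet derivatives depend only on the values in that set, so
  the equality of \<open>f\<close> and \<open>g\<close> passes to their derivatives.\<close>

lemma Ck_on_cong:
  assumes "open U" "\<And>x. x \<in> U \<Longrightarrow> f x = g x" "Ck_on k U f"
  shows "Ck_on k U g"
  using assms(2,3)
proof (induction k arbitrary: f g)
  case 0
  then show ?case using continuous_on_cong[of U U f g] by simp
next
  case (Suc k)
  have d: "(g has_derivative frechet_derivative f (at x)) (at x)" if "x \<in> U" for x
    using Suc.prems has_derivative_transform_within_open[OF _ assms(1) that, of f "frechet_derivative f (at x)" UNIV g]
      that by (simp add: frechet_derivative_works)
  then have eq: "frechet_derivative f (at x) = frechet_derivative g (at x)" if "x \<in> U" for x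
    using frechet_derivative_at that by blast
  have "Ck_on k U (\<lambda>x. frechet_derivative g (at x) v)" for v
    by (rule Suc.IH[of "\<lambda>x. frechet_derivative f (at x) v"]) (use Suc.prems eq in auto)
  then show ?case using d by (auto simp: differentiable_def)
qed

text \<open>The factor \<open>c\<close> makes the induction close: differentiation in direction
  \<open>v\<close> gives a map of the same form, with \<open>c * v\<close> for \<open>c\<close> and
  the derivative of \<open>f\<close> along \<open>e\<close> for \<open>f\<close>.\<close>

lemma Ck_on_scaleR_line:
  assumes "open I" "\<And>t. t \<in> I \<Longrightarrow> x + t *\<^sub>R e \<in> U" "Ck_on k U f"
  shows "Ck_on k I (\<lambda>t::real. c *\<^sub>R f (x + t *\<^sub>R e))"
  using assms(3)
proof (induction k arbitrary: f c)
  case 0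
  then show ?case
    using assms(2) by (auto intro!: continuous_intros continuous_on_compose2[of U f])
next
  case (Suc k)
  have d: "((\<lambda>t. c *\<^sub>R f (x + t *\<^sub>R e)) has_derivative
      (\<lambda>v. (c * v) *\<^sub>R frechet_derivative f (at (x + t *\<^sub>R e)) e)) (at t)" if "t \<in> I" for t
  proof -
    have f: "(f has_derivative frechet_derivative f (at (x + t *\<^sub>R e))) (at (x + t *\<^sub>R e))"
      using Suc.prems assms(2)[OF that] by (simp add: frechet_derivative_works)
    have "((\<lambda>t. x + t *\<^sub>R e) has_derivative (\<lambda>h. h *\<^sub>R e)) (at t)"
      by (auto intro!: derivative_eq_intros)
    from has_derivative_scaleR_right[OF has_derivative_compose[OF this f], of c]
    show ?thesis
      using linear_cmul[OF has_derivative_linear[OF f]] by simp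
  qed
  have "Ck_on k I (\<lambda>t. frechet_derivative (\<lambda>t. c *\<^sub>R f (x + t *\<^sub>R e)) (at t) v)" for v
  proof (rule Ck_on_cong[OF assms(1)])
    show "Ck_on k I (\<lambda>t. (c * v) *\<^sub>R frechet_derivative f (at (x + t *\<^sub>R e)) e)"
      using Suc.IH[of "\<lambda>y. frechet_derivative f (at y) e"] Suc.prems by simp
    show "(c * v) *\<^sub>R frechet_derivative f (at (x + t *\<^sub>R e)) e =
        frechet_derivative (\<lambda>t. c *\<^sub>R f (x + t *\<^sub>R e)) (at t) v" if "t \<in> I" for t
      using fun_cong[OF frechet_derivative_at[OF d[OF that]], of v] .
  qed
  then show ?case using d by (auto simp: differentiable_def)
qed

text \<open>The witnessing curve is the image under \<phi> of the segment through \<open>x\<close>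
  in direction \<open>e\<close>.\<close>

lemma parametrization_derivative_in_tangent_space:
  fixes \<phi> :: "real^2 \<Rightarrow> real^3"
  assumes "open U" "x \<in> U" "Cinf_on U \<phi>" "\<phi> ` U \<subseteq> S"
  shows "frechet_derivative \<phi> (at x) e \<in> tangent_space S (\<phi> x)"
proof -
  obtain r where r: "r > 0" "ball x r \<subseteq> U" using assms(1,2) openE by blast
  \<comment> \<open>Adding 1 in the denominator covers the case \<open>e = 0\<close>.\<close>
  define d where "d = r / (norm e + 1)"
  have d: "d > 0" using r by (simp add: d_def add_nonneg_pos)
  have inU: "x + t *\<^sub>R e \<in> U" if "t \<in> {-d<..<d}" for t
  proof -
    have "\<bar>t\<bar> * (norm e + 1) < r"
      using that by (simp add: d_def pos_less_divide_eq[symmetric] add_nonneg_pos abs_less_iff)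
    moreover have "\<bar>t\<bar> * norm e \<le> \<bar>t\<bar> * (norm e + 1)" by (intro mult_left_mono) auto
    ultimately show ?thesis using r(2) by (auto simp: subset_iff dist_norm)
  qed
  have "Cinf_on {-d<..<d} (\<lambda>t. \<phi> (x + t *\<^sub>R e))"
    using Ck_on_scaleR_line[of "{-d<..<d}" x e U _ \<phi> 1] inU assms(3) by (simp add: Cinf_on_def)
  moreover have "(\<lambda>t. \<phi> (x + t *\<^sub>R e)) ` {-d<..<d} \<subseteq> S" using inU assms(4) by blast
  moreover have "((\<lambda>t. \<phi> (x + t *\<^sub>R e)) has_vector_derivative frechet_derivative \<phi> (at x) e) (at 0)"
  proof -
    have "Ck_on (Suc 0) U \<phi>" using assms(3) unfolding Cinf_on_def by blast
    then have f: "(\<phi> has_derivative frechet_derivative \<phi> (at x)) (at (x + 0 *\<^sub>R e))"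
      using assms(2) by (simp add: frechet_derivative_works)
    have "((\<lambda>t. x + t *\<^sub>R e) has_derivative (\<lambda>h. h *\<^sub>R e)) (at 0)"
      by (auto intro!: derivative_eq_intros)
    from has_derivative_compose[OF this f] show ?thesis
      using linear_cmul[OF has_derivative_linear[OF f]] by (simp add: has_vector_derivative_def)
  qed
  ultimately show ?thesis
    unfolding tangent_space_def using d by (intro CollectI exI[of _ d] conjI exI[of _ "\<lambda>t. \<phi> (x + t *\<^sub>R e)"]) auto
qed

section \<open>Components in the left-invariant frame\<close>

text \<open>The position-dependent part of \<open>heis_form\<close>, split off because it is
  bilinear in base point and vector and so obeys a product rule.\<close>

definition twist :: "real^3 \<Rightarrow> real^3 \<Rightarrow> real^3" where
  "twist p v = ((p$2 * v$1 - p$1 * v$2) / 2) *\<^sub>R axis 3 1"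

text \<open>Components of \<open>v\<close> at \<open>p\<close> in the left-invariant orthonormal
  frame \<open>\<partial>\<^sub>x - y/2 \<partial>\<^sub>z\<close>,
  \<open>\<partial>\<^sub>y + x/2 \<partial>\<^sub>z\<close>,
  \<open>\<partial>\<^sub>z\<close>.\<close>

definition heis_frame :: "real^3 \<Rightarrow> real^3 \<Rightarrow> real^3" where
  "heis_frame p v = v + twist p v"

lemma bounded_bilinear_twist: "bounded_bilinear twist"
  unfolding bilinear_conv_bounded_bilinear[symmetric] bilinear_def
  by (auto intro!: linearI simp: twist_def vec_eq_iff forall_3 axis_def field_simps)

text \<open>Source of the torsion term: this is what remains of the difference of the cross
  derivatives of the two coordinate fields once the mixed derivatives of the parametrization
  cancel.\<close>

lemma twist_antisym_diff: "twist w v - twist v w = (v$1 * w$2 - v$2 * w$1) *\<^sub>R axis 3 1"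
  by (simp add: twist_def vec_eq_iff axis_def field_simps)

lemma heis_frame_nth [simp]:
  "heis_frame p v $ 1 = v $ 1" "heis_frame p v $ 2 = v $ 2" "heis_frame p v $ 3 = heis_form p v"
  by (simp_all add: heis_frame_def twist_def axis_def heis_form_def field_simps)

lemma heis_metric_eq_inner_frame: "heis_metric p u v = heis_frame p u \<bullet> heis_frame p v"
  by (simp add: heis_metric_def inner_vec_def sum_3)

lemma linear_heis_frame: "linear (heis_frame p)"
  by (rule linearI) (simp_all add: vec_eq_iff forall_3 heis_form_def algebra_simps)

lemma heis_frame_eq_0_iff: "heis_frame p v = 0 \<longleftrightarrow> v = 0"
  by (auto simp: vec_eq_iff forall_3 heis_form_def)

lemma has_derivative_heis_frame:
  assumes "(f has_derivative f') (at x)" "(g has_derivative g') (at x)"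
  shows "((\<lambda>y. heis_frame (f y) (g y)) has_derivative
    (\<lambda>h. heis_frame (f x) (g' h) + twist (f' h) (g x))) (at x)"
  unfolding heis_frame_def add.assoc
  by (intro has_derivative_add assms bounded_bilinear.FDERIV[OF bounded_bilinear_twist])

text \<open>Passage from Christoffel symbols to the frame: the first two terms are the derivative
  along \<open>v\<close> of the frame components of \<open>Y\<close>, the \<open>twist\<close> being
  due to the moving base point, and \<open>conn\<close> is the connection part.\<close>

lemma nabla_heis_frame:
  "heis_frame p (nabla heis_metric Y p v) = heis_frame p (frechet_derivative Y (at p) v)
     + twist v (Y p) + conn (heis_frame p v) (heis_frame p (Y p))"
  by (simp add: nabla_def christoffel_heis vec_eq_iff forall_3 sum_3 conn_def twist_def axis_def
      heis_form_def field_simps power2_eq_square)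

text \<open>A vanishing cross product makes the two images linearly dependent, which yields a
  nonzero vector in the kernel of an injective linear map.\<close>

lemma cross_frame_nonzero:
  fixes T :: "real^2 \<Rightarrow> real^3"
  assumes "linear T" "inj T"
  shows "cross3 (heis_frame p (T (axis 1 1))) (heis_frame p (T (axis 2 1))) \<noteq> 0"
proof
  define L where "L = (\<lambda>h. heis_frame p (T h))"
  have L: "linear L"
    using linear_compose[OF assms(1) linear_heis_frame] by (simp add: L_def o_def)
  have L0: "h = 0" if "L h = 0" for h
    using that assms by (simp add: L_def heis_frame_eq_0_iff linear_injective_0)
  assume "cross3 (heis_frame p (T (axis 1 1))) (heis_frame p (T (axis 2 1))) = 0"
  then have "collinear {0, L (axis 1 1), L (axis 2 1)}"
    by (simp add: cross_eq_0 L_def)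
  then consider "L (axis 1 1) = 0" | "L (axis 2 1) = 0"
    | c where "L (axis 2 1) = c *\<^sub>R L (axis 1 1)"
    unfolding collinear_lemma by blast
  then show False
  proof cases
    case 3
    then have "L (axis 2 1 - c *\<^sub>R axis 1 1) = 0"
      using L by (simp add: linear_diff linear_cmul)
    from arg_cong[OF L0[OF this], of "\<lambda>z. z $ 2"] show False by (simp add: axis_def)
  qed (use L0 in \<open>force simp: axis_eq_0_iff\<close>)+
qed

section \<open>Unit normals along a parametrized piece\<close>

text \<open>Both fields are parallel to \<open>cross3 (a y) (b y)\<close>, so their inner product is
  1 or -1 at each point; by continuity it is locally constant.\<close>

lemma unit_normals_eq_or_opposite:
  fixes n m a b :: "'a::real_normed_vector \<Rightarrow> real^3"
  assumes U: "open U" "x \<in> U" and cont: "isCont n x" "isCont m x"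
    and n: "\<And>y. y \<in> U \<Longrightarrow> n y \<bullet> n y = 1" "\<And>y. y \<in> U \<Longrightarrow> n y \<bullet> a y = 0"
      "\<And>y. y \<in> U \<Longrightarrow> n y \<bullet> b y = 0"
    and m: "\<And>y. y \<in> U \<Longrightarrow> m y \<bullet> m y = 1" "\<And>y. y \<in> U \<Longrightarrow> m y \<bullet> a y = 0"
      "\<And>y. y \<in> U \<Longrightarrow> m y \<bullet> b y = 0"
    and ab: "\<And>y. y \<in> U \<Longrightarrow> cross3 (a y) (b y) \<noteq> 0"
  obtains s :: real where "\<forall>\<^sub>F y in nhds x. n y = s *\<^sub>R m y"
proof -
  have nm: "n y = (n y \<bullet> m y) *\<^sub>R m y" "n y \<bullet> m y = 1 \<or> n y \<bullet> m y = -1" if y: "y \<in> U" for y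
  proof -
    define c where "c = cross3 (a y) (b y)"
    have c: "c = (c \<bullet> n y) *\<^sub>R n y" "c = (c \<bullet> m y) *\<^sub>R m y" "c \<noteq> 0"
      using cross_eq_scaleR_normal[OF n[OF y]] cross_eq_scaleR_normal[OF m[OF y]] ab[OF y]
      by (simp_all add: c_def)
    then have "c \<bullet> n y \<noteq> 0" by auto
    then have "n y = (1 / (c \<bullet> n y)) *\<^sub>R ((c \<bullet> n y) *\<^sub>R n y)" by simp
    also have "\<dots> = (1 / (c \<bullet> n y)) *\<^sub>R ((c \<bullet> m y) *\<^sub>R m y)"
      by (simp only: c(1)[symmetric] c(2)[symmetric])
    also have "\<dots> = (c \<bullet> m y / (c \<bullet> n y)) *\<^sub>R m y" by simp
    finally obtain k where k: "n y = k *\<^sub>R m y" by blast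
    then have "n y \<bullet> m y = k" "k * k = 1" using m(1)[OF y] n(1)[OF y] by simp_all
    then show "n y = (n y \<bullet> m y) *\<^sub>R m y" "n y \<bullet> m y = 1 \<or> n y \<bullet> m y = -1"
      using k by (auto simp: square_eq_1_iff)
  qed
  have "((\<lambda>y. n y \<bullet> m y) \<longlongrightarrow> n x \<bullet> m x) (nhds x)"
    using cont by (intro tendsto_inner) (simp_all add: continuous_at tendsto_nhds_iff)
  \<comment> \<open>The bound 1 is below the gap 2 between the two possible values.\<close>
  then have "\<forall>\<^sub>F y in nhds x. dist (n y \<bullet> m y) (n x \<bullet> m x) < 1"
    by (rule tendstoD) simp
  moreover have "\<forall>\<^sub>F y in nhds x. y \<in> U" using U by (rule eventually_nhds_in_open)
  ultimately have "\<forall>\<^sub>F y in nhds x. n y = (n x \<bullet> m x) *\<^sub>R m y"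
  proof eventually_elim
    case (elim y)
    then have "n y \<bullet> m y = n x \<bullet> m x"
      using nm(2)[of y] nm(2)[OF U(2)] by (auto simp: dist_real_def)
    then show ?case using nm(1)[OF elim(2)] by simp
  qed
  then show ?thesis by (rule that)
qed

lemma Cinf_on_has_derivative:
  "Cinf_on U f \<Longrightarrow> x \<in> U \<Longrightarrow> (f has_derivative frechet_derivative f (at x)) (at x)"
  "Cinf_on U f \<Longrightarrow> x \<in> U \<Longrightarrow> ((\<lambda>y. frechet_derivative f (at y) v) has_derivative
     frechet_derivative (\<lambda>y. frechet_derivative f (at y) v) (at x)) (at x)"
proof -
  assume f: "Cinf_on U f" "x \<in> U"
  then have "Ck_on (Suc (Suc 0)) U f" unfolding Cinf_on_def by blast
  then show "(f has_derivative frechet_derivative f (at x)) (at x)"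
    "((\<lambda>y. frechet_derivative f (at y) v) has_derivative
     frechet_derivative (\<lambda>y. frechet_derivative f (at y) v) (at x)) (at x)"
    using f(2) by (simp_all add: frechet_derivative_works[symmetric])
qed

text \<open>\<open>Cinf_on\<close> controls the derivative of \<open>f\<close> in fixed directions,
  so the varying direction \<open>w y\<close> is expanded in the standard basis.\<close>

lemma differentiable_derivative_along:
  fixes f :: "real^3 \<Rightarrow> 'b::real_normed_vector" and \<phi> w :: "'a::real_normed_vector \<Rightarrow> real^3"
  assumes "open U" "x \<in> U" "Cinf_on W f" "\<And>y. y \<in> U \<Longrightarrow> \<phi> y \<in> W"
    and \<phi>: "(\<phi> has_derivative \<phi>') (at x)" and w: "(w has_derivative w') (at x)"
  shows "(\<lambda>y. frechet_derivative f (at (\<phi> y)) (w y)) differentiable (at x)"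
proof -
  let ?g = "\<lambda>y. \<Sum>i\<in>UNIV. w y $ i *\<^sub>R frechet_derivative f (at (\<phi> y)) (axis i 1)"
  have eq: "?g y = frechet_derivative f (at (\<phi> y)) (w y)" if "y \<in> U" for y
  proof -
    have L: "linear (frechet_derivative f (at (\<phi> y)))"
      using Cinf_on_has_derivative(1)[OF assms(3) assms(4)[OF that]] by (rule has_derivative_linear)
    have "frechet_derivative f (at (\<phi> y)) (\<Sum>i\<in>UNIV. w y $ i *\<^sub>R axis i 1) = ?g y"
      by (simp add: linear_sum[OF L] linear_cmul[OF L])
    moreover have "(\<Sum>i\<in>UNIV. w y $ i *\<^sub>R axis i 1) = w y"
      using basis_expansion[of "w y"] by (simp add: scalar_mult_eq_scaleR)
    ultimately show ?thesis by simp
  qed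
  have "\<exists>g'. (?g has_derivative g') (at x)"
    by (rule exI, rule has_derivative_sum, rule has_derivative_scaleR[OF has_derivative_nth[OF w]
      has_derivative_compose[OF \<phi> Cinf_on_has_derivative(2)[OF assms(3) assms(4)[OF assms(2)]]]])
  then obtain g' where g': "(?g has_derivative g') (at x)" by blast
  have "((\<lambda>y. frechet_derivative f (at (\<phi> y)) (w y)) has_derivative g') (at x)"
    by (rule has_derivative_transform_within_open[OF g' assms(1,2)]) (rule eq)
  then show ?thesis by (auto simp: differentiable_def)
qed

text \<open>Turns a statement about \<open>nabla\<close> into a differential equation for frame
  components; for an umbilical normal it gives the first-order system.\<close>

lemma has_derivative_normal_frame:
  assumes \<phi>: "(\<phi> has_derivative \<phi>') (at x)" and Y: "Y differentiable (at (\<phi> x))"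
  shows "((\<lambda>y. heis_frame (\<phi> y) (Y (\<phi> y))) has_derivative
    (\<lambda>h. heis_frame (\<phi> x) (nabla heis_metric Y (\<phi> x) (\<phi>' h))
       - conn (heis_frame (\<phi> x) (\<phi>' h)) (heis_frame (\<phi> x) (Y (\<phi> x))))) (at x)"
  using has_derivative_heis_frame[OF \<phi> has_derivative_compose[OF \<phi> Y[unfolded frechet_derivative_works]]]
  by (simp add: nabla_heis_frame)

section \<open>The umbilicity system on a parametrized piece and its contradiction\<close>

theorem theorem4p3:
  shows "\<not> (\<exists>S. S \<noteq> {} \<and> smooth_surface S \<and> totally_umbilical heis_metric S)"
proof (rule notI, elim exE conjE)
  fix S :: "(real^3) set"
  assume "S \<noteq> {}" and surf: "smooth_surface S" and umb: "totally_umbilical heis_metric S"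
  then obtain p where p: "p \<in> S" by blast
  from bspec[OF surf[unfolded smooth_surface_def] p] obtain U :: "(real^2) set" and V \<phi> \<psi>
    where U: "open U" "p \<in> V" and \<phi>: "Cinf_on U \<phi>"
    and inj: "\<forall>u\<in>U. inj (frechet_derivative \<phi> (at u))"
    and hom: "homeomorphism U (S \<inter> V) \<phi> \<psi>"
    by (elim exE conjE)
  \<comment> \<open>Umbilicity at \<open>p\<close> supplies one normal field on \<open>W\<close>,
    kept fixed from here on. At other points umbilicity may come with a different local
    normal.\<close>
  from bspec[OF umb[unfolded totally_umbilical_def] p] obtain W \<eta>
    where W: "p \<in> W" and \<eta>: "unit_normal_on heis_metric S W \<eta>"
    unfolding umbilical_at_def by (elim exE conjE)
  define n where "n \<eta> x = heis_frame (\<phi> x) (\<eta> (\<phi> x))" for \<eta> and x :: "real^2"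
  define d where "d x = frechet_derivative \<phi> (at x)" for x
  define A where "A x h = heis_frame (\<phi> x) (d x h)" for x h
  let ?u = "axis 1 1 :: real^2" and ?v = "axis 2 1 :: real^2"
  have S: "\<phi> ` U \<subseteq> S" using hom by (auto simp: homeomorphism_def)
  have d: "(\<phi> has_derivative d x) (at x)" if "x \<in> U" for x
    unfolding d_def using Cinf_on_has_derivative(1)[OF \<phi> that] .
  have dd: "((\<lambda>y. d y h) has_derivative frechet_derivative (\<lambda>y. d y h) (at x)) (at x)" if "x \<in> U" for x h
    unfolding d_def using Cinf_on_has_derivative(2)[OF \<phi> that] .
  have A: "((\<lambda>y. A y h) has_derivative (\<lambda>k. heis_frame (\<phi> x) (frechet_derivative (\<lambda>y. d y h) (at x) k)
      + twist (d x k) (d x h))) (at x)" if "x \<in> U" for x h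
    unfolding A_def by (rule has_derivative_heis_frame[OF d[OF that] dd[OF that]])
  have cross: "cross3 (A x ?u) (A x ?v) \<noteq> 0" if "x \<in> U" for x
    unfolding A_def using cross_frame_nonzero[OF has_derivative_linear[OF d[OF that]]] inj that
    by (simp add: d_def)
  have tangent: "d x h \<in> tangent_space S (\<phi> x)" if "x \<in> U" for x h
    unfolding d_def by (rule parametrization_derivative_in_tangent_space[OF U(1) that \<phi> S])
  have openU: "open {x \<in> U. \<phi> x \<in> W}" if "open W" for W
  proof -
    have "continuous_on U \<phi>" using hom by (simp add: homeomorphism_def)
    from continuous_open_preimage[OF this U(1) that] show ?thesis
      by (simp add: vimage_def Int_def)
  qed
  have normal: "n \<eta> x \<bullet> n \<eta> x = 1" "n \<eta> x \<bullet> A x h = 0"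
    if "unit_normal_on heis_metric S W \<eta>" "x \<in> U" "\<phi> x \<in> W" for W \<eta> x h
    using that S tangent[of x h] unfolding unit_normal_on_def n_def A_def heis_metric_eq_inner_frame
    by blast+
  have n': "(n \<eta> has_derivative (\<lambda>h. heis_frame (\<phi> x) (nabla heis_metric \<eta> (\<phi> x) (d x h))
       - conn (A x h) (n \<eta> x))) (at x)"
    if "unit_normal_on heis_metric S W \<eta>" "x \<in> U" "\<phi> x \<in> W" for W \<eta> x
    using has_derivative_normal_frame[OF d[OF that(2)], of \<eta>]
      Cinf_on_has_derivative(1)[of W \<eta> "\<phi> x"] that
    by (auto simp: n_def[abs_def] A_def unit_normal_on_def differentiable_def)

  define U' where "U' = {x \<in> U. \<phi> x \<in> W}"
  have U': "open U'" using openU \<eta> by (simp add: U'_def unit_normal_on_def)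
  have "\<psi> p \<in> U'" using hom p U(2) W by (auto simp: U'_def homeomorphism_def)
  then have "U' \<noteq> {}" by blast
  define n' where "n' x = frechet_derivative (n \<eta>) (at x)" for x
  have dn: "(n \<eta> has_derivative n' x) (at x)" if "x \<in> U'" for x
    using n'[OF \<eta>, of x] that unfolding U'_def n'_def
    by (auto simp: frechet_derivative_works[symmetric] differentiable_def)
  \<comment> \<open>Umbilicity at \<open>\<phi> x\<close> is given for its own normal
    \<open>\<eta>'\<close>. Near \<open>x\<close> the fixed normal is \<open>s\<close> times it, so
    the equation carries over with factor \<open>s * l\<close>.\<close>
  have "\<exists>l. \<forall>h. n' x h = - l *\<^sub>R A x h - conn (A x h) (n \<eta> x)" if x: "x \<in> U'" for x
  proof -
    have xU: "x \<in> U" "\<phi> x \<in> W" using x by (auto simp: U'_def)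
    then have "\<phi> x \<in> S" using S by blast
    from bspec[OF umb[unfolded totally_umbilical_def] this] obtain W' \<eta>' l where W': "\<phi> x \<in> W'" and \<eta>': "unit_normal_on heis_metric S W' \<eta>'"
      and l: "\<forall>v\<in>tangent_space S (\<phi> x). weingarten heis_metric \<eta>' (\<phi> x) v = l *\<^sub>R v"
      unfolding umbilical_at_def by (elim exE conjE)
    have "nabla heis_metric \<eta>' (\<phi> x) (d x h) = - l *\<^sub>R d x h" for h
      using bspec[OF l tangent[OF xU(1), of h]] by (simp add: weingarten_def minus_equation_iff)
    then have dn2: "(n \<eta>' has_derivative (\<lambda>h. - l *\<^sub>R A x h - conn (A x h) (n \<eta>' x))) (at x)"
      using n'[OF \<eta>' xU(1) W'] linear_cmul[OF linear_heis_frame, of "\<phi> x" "- l"] by (simp add: A_def)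
    have "open {y \<in> U. \<phi> y \<in> W \<inter> W'}"
      using openU[of "W \<inter> W'"] \<eta> \<eta>' by (simp add: unit_normal_on_def open_Int)
    then obtain s where s: "\<forall>\<^sub>F y in nhds x. n \<eta> y = s *\<^sub>R n \<eta>' y"
    proof (rule unit_normals_eq_or_opposite[where n = "n \<eta>" and m = "n \<eta>'"
          and a = "\<lambda>y. A y ?u" and b = "\<lambda>y. A y ?v"])
      show "isCont (n \<eta>) x" "isCont (n \<eta>') x"
        using dn[OF x] dn2 by (auto intro: has_derivative_continuous)
    qed (use xU W' normal[OF \<eta>] normal[OF \<eta>'] cross in auto)
    have "((\<lambda>y. s *\<^sub>R n \<eta>' y) has_derivative
        (\<lambda>h. s *\<^sub>R (- l *\<^sub>R A x h - conn (A x h) (n \<eta>' x)))) (at x)"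
      by (intro has_derivative_scaleR_right dn2)
    moreover have "\<forall>\<^sub>F y in at x. s *\<^sub>R n \<eta>' y = n \<eta> y"
      using s by (auto simp: eventually_at_filter elim: eventually_mono)
    moreover have sx: "s *\<^sub>R n \<eta>' x = n \<eta> x" using eventually_nhds_x_imp_x[OF s] by simp
    ultimately have "(n \<eta> has_derivative
        (\<lambda>h. s *\<^sub>R (- l *\<^sub>R A x h - conn (A x h) (n \<eta>' x)))) (at x)"
      using has_derivative_transform_eventually[where s=UNIV] by blast
    then have "n' x = (\<lambda>h. s *\<^sub>R (- l *\<^sub>R A x h - conn (A x h) (n \<eta>' x)))"
      using dn[OF x] has_derivative_unique by blast
    then have "\<forall>h. n' x h = - (s * l) *\<^sub>R A x h - conn (A x h) (n \<eta> x)"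
      by (simp add: sx[symmetric] bounded_bilinear.scaleR_right[OF bounded_bilinear_conn]
          scaleR_diff_right)
    then show ?thesis by blast
  qed
  then obtain l where l: "\<And>x h. x \<in> U' \<Longrightarrow> n' x h = - l x *\<^sub>R A x h - conn (A x h) (n \<eta> x)"
    by metis
  \<comment> \<open>\<open>l\<close> was only chosen pointwise; it is regular because the system can be solved for it.\<close>
  have dl: "l differentiable (at x)" if x: "x \<in> U'" for x
  proof -
    have xU: "x \<in> U" "\<phi> x \<in> W" using x by (auto simp: U'_def)
    have \<eta>W: "Cinf_on W \<eta>" using \<eta> by (simp add: unit_normal_on_def)
    \<comment> \<open>Writing \<open>n' y ?u\<close> through the derivative of the smooth field
      \<eta> makes its differentiability in \<open>y\<close> accessible.\<close>
    have n'u: "n' y ?u = heis_frame (\<phi> y) (frechet_derivative \<eta> (at (\<phi> y)) (d y ?u))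
        + twist (d y ?u) (\<eta> (\<phi> y))" if "y \<in> U'" for y
    proof -
      have yU: "y \<in> U" "\<phi> y \<in> W" using that by (auto simp: U'_def)
      have "(n \<eta> has_derivative (\<lambda>h. heis_frame (\<phi> y) (frechet_derivative \<eta> (at (\<phi> y)) (d y h))
          + twist (d y h) (\<eta> (\<phi> y)))) (at y)"
        unfolding n_def[abs_def]
        by (rule has_derivative_heis_frame[OF d[OF yU(1)] has_derivative_compose[OF d[OF yU(1)]
            Cinf_on_has_derivative(1)[OF \<eta>W yU(2)]]])
      from fun_cong[OF has_derivative_unique[OF dn[OF that] this], of ?u] show ?thesis .
    qed
    \<comment> \<open>On \<open>U'\<close> this is \<open>- l y *\<^sub>R A y ?u\<close>; the inner
      product with the nonvanishing \<open>A y ?u\<close> recovers \<open>l y\<close> as a quotient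
      of differentiable functions.\<close>
    let ?m = "\<lambda>y. heis_frame (\<phi> y) (frechet_derivative \<eta> (at (\<phi> y)) (d y ?u))
        + twist (d y ?u) (\<eta> (\<phi> y)) + conn (A y ?u) (n \<eta> y)"
    have "(\<lambda>y. frechet_derivative \<eta> (at (\<phi> y)) (d y ?u)) differentiable (at x)"
      by (rule differentiable_derivative_along[OF U' x \<eta>W _ d dd]) (use xU U'_def in auto)
    then obtain e' where e':
      "((\<lambda>y. frechet_derivative \<eta> (at (\<phi> y)) (d y ?u)) has_derivative e') (at x)"
      by (auto simp: differentiable_def)
    have "?m differentiable (at x)"
      unfolding differentiable_def
      by (rule exI, rule has_derivative_add[OF has_derivative_add[OF
            has_derivative_heis_frame[OF d[OF xU(1)] e']
            bounded_bilinear.FDERIV[OF bounded_bilinear_twist dd[OF xU(1)]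
              has_derivative_compose[OF d[OF xU(1)] Cinf_on_has_derivative(1)[OF \<eta>W xU(2)]]]]
            bounded_bilinear.FDERIV[OF bounded_bilinear_conn A[OF xU(1)] dn[OF x]]])
    moreover have Ax: "(\<lambda>y. A y ?u) differentiable (at x)"
      using A[OF xU(1)] by (auto simp: differentiable_def)
    moreover have A0: "A y ?u \<bullet> A y ?u \<noteq> 0" if "y \<in> U'" for y
      using cross[of y] that by (auto simp: U'_def)
    ultimately have "(\<lambda>y. - (?m y \<bullet> A y ?u) / (A y ?u \<bullet> A y ?u)) differentiable (at x)"
      using x by (intro differentiable_divide differentiable_minus differentiable_inner)
    then obtain m' where m': "((\<lambda>y. - (?m y \<bullet> A y ?u) / (A y ?u \<bullet> A y ?u)) has_derivative m') (at x)"
      unfolding differentiable_def by blast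
    have "- (?m y \<bullet> A y ?u) / (A y ?u \<bullet> A y ?u) = l y" if "y \<in> U'" for y
    proof -
      have "?m y = - l y *\<^sub>R A y ?u"
        unfolding n'u[OF that, symmetric] l[OF that] by simp
      then show ?thesis using A0[OF that] by simp
    qed
    then have "(l has_derivative m') (at x)"
      by (rule has_derivative_transform_within_open[OF m' U' x])
    then show ?thesis unfolding differentiable_def by blast
  qed
  show False
  proof (rule no_umbilical_frame_solution[OF U' \<open>U' \<noteq> {}\<close>])
    show "((\<lambda>y. A y ?u) has_derivative (\<lambda>k. heis_frame (\<phi> x)
        (frechet_derivative (\<lambda>y. d y ?u) (at x) k) + twist (d x k) (d x ?u))) (at x)"
      "((\<lambda>y. A y ?v) has_derivative (\<lambda>k. heis_frame (\<phi> x)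
        (frechet_derivative (\<lambda>y. d y ?v) (at x) k) + twist (d x k) (d x ?v))) (at x)"
      if "x \<in> U'" for x using A that by (simp_all add: U'_def)
    show "(n \<eta> has_derivative n' x) (at x)" if "x \<in> U'" for x using dn[OF that] .
    show "(l has_derivative frechet_derivative l (at x)) (at x)" if "x \<in> U'" for x
      using dl[OF that] by (simp add: frechet_derivative_works)
    show "n \<eta> x \<bullet> n \<eta> x = 1" "n \<eta> x \<bullet> A x ?u = 0" "n \<eta> x \<bullet> A x ?v = 0"
      "cross3 (A x ?u) (A x ?v) \<noteq> 0" if "x \<in> U'" for x
      using normal[OF \<eta>] cross that by (auto simp: U'_def)
    show "n' x ?u = - l x *\<^sub>R A x ?u - conn (A x ?u) (n \<eta> x)"
      "n' x ?v = - l x *\<^sub>R A x ?v - conn (A x ?v) (n \<eta> x)" if "x \<in> U'" for x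
      using l[OF that] by blast+
    \<comment> \<open>The mixed second derivatives of \<phi> agree, so just the difference of the
      two \<open>twist\<close> terms survives.\<close>
    show "heis_frame (\<phi> x) (frechet_derivative (\<lambda>y. d y ?u) (at x) ?v) + twist (d x ?v) (d x ?u)
        - (heis_frame (\<phi> x) (frechet_derivative (\<lambda>y. d y ?v) (at x) ?u) + twist (d x ?u) (d x ?v))
        = (A x ?u $ 1 * A x ?v $ 2 - A x ?u $ 2 * A x ?v $ 1) *\<^sub>R axis 3 1" if "x \<in> U'" for x
    proof -
      have "x \<in> U" using that by (simp add: U'_def)
      then have "frechet_derivative (\<lambda>y. d y ?u) (at x) ?v = frechet_derivative (\<lambda>y. d y ?v) (at x) ?u"
        by (intro mixed_derivatives_commute[OF U(1) _ d dd dd])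
      then show ?thesis by (simp add: A_def twist_antisym_diff)
    qed
  qed
qed

end
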